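(* Let $n\ge 3$, let $\rho>0$, let $B_\rho\subset\mathbb{R}^n$ be the open ball of radius $\rho$ centred at the origin, let $a<b$ be real numbers, and let $W\in C^{1,1}_{loc}(\mathbb{R})$ be a potential such that $W'(a)=W'(b)=0$, $W'<0$ on $(a,b)$, and such that for some $C_0>0$ and $s_0\in(a,b)$ one has $W'(s)\le -C_0(s-a)^{\frac{n}{n-2}}$ for all $s\in[a,s_0]$. Then every solution $u\in C^2(\mathbb{R}^n\setminus B_\rho)$ to $\Delta u=W'(u)$ such that $u(\mathbb{R}^n\setminus B_\rho)\subset(a,b)$ satisfies $\lim_{|x|\to\infty}u(x)=b$. *)

theory Defs
  imports "HOL-Analysis.Analysis"
begin

text \<open>
  On a closed set \<open>S\<close>, derivatives are taken within \<open>S\<close>: the ordinary ones at interior points,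
  one-sided up to the boundary. \<^const>\<open>frechet_derivative\<close> is a choice operator; it is determined
  as soon as derivatives within \<open>S\<close> are unique. For \<open>S = - ball 0 \<rho>\<close> this holds also at boundary
  points: for each coordinate vector \<open>v\<close>, one of \<open>x + t *\<^sub>R v\<close>, \<open>x - t *\<^sub>R v\<close> stays in \<open>S\<close>
  for all \<open>t \<ge> 0\<close> (see \<open>frechet_derivative_unique_within\<close>).
\<close>

definition partial_on :: "'a::euclidean_space set \<Rightarrow> 'a \<Rightarrow> ('a \<Rightarrow> real) \<Rightarrow> 'a \<Rightarrow> real" where
  "partial_on S v f x = frechet_derivative f (at x within S) v"

definition C1_on :: "'a::euclidean_space set \<Rightarrow> ('a \<Rightarrow> real) \<Rightarrow> bool" where
  "C1_on S f \<longleftrightarrow> f differentiable_on S \<and> (\<forall>v\<in>Basis. continuous_on S (partial_on S v f))"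

definition C2_on :: "'a::euclidean_space set \<Rightarrow> ('a \<Rightarrow> real) \<Rightarrow> bool" where
  "C2_on S f \<longleftrightarrow> C1_on S f \<and> (\<forall>v\<in>Basis. C1_on S (partial_on S v f))"

definition laplacian_on :: "'a::euclidean_space set \<Rightarrow> ('a \<Rightarrow> real) \<Rightarrow> 'a \<Rightarrow> real" where
  "laplacian_on S f x = (\<Sum>v\<in>Basis. partial_on S v (partial_on S v f) x)"

definition C11_loc :: "(real \<Rightarrow> real) \<Rightarrow> bool" where
  "C11_loc W \<longleftrightarrow> (\<forall>s. W differentiable (at s)) \<and>
    (\<forall>K. compact K \<longrightarrow> (\<exists>L. L-lipschitz_on K (deriv W)))"

end

theory Submission imports Defs "HOL-Real_Asymp.Real_Asymp" begin

text \<open>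
  Put \<open>v = u - a > 0\<close>, so that \<open>v\<close> is strictly superharmonic. The only analytic tool is that
  \<open>\<Delta>(u - \<phi>) \<ge> 0\<close> at an interior local minimum of \<open>u - \<phi>\<close>, for radial \<open>\<phi>\<close>.
  Comparison with the fundamental solution gives \<open>v \<ge> c |x|\<^sup>2\<^sup>-\<^sup>n\<close>; inserting this into
  \<open>- \<Delta>v \<ge> C v powr (n / (n - 2))\<close> and comparing once more improves it, because the exponent is
  critical, to \<open>v \<ge> \<epsilon> |x|\<^sup>2\<^sup>-\<^sup>n ln |x|\<close>. On the other hand, at a point where the paraboloid
  \<open>- k |x - x0|\<^sup>2\<close> touches \<open>v\<close> from below in a ball of radius \<open>r\<close> one has \<open>- \<Delta>v \<le> O(v(x0) / r\<^sup>2)\<close>.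
  With \<open>x0\<close> a minimum point of \<open>v\<close> on \<open>|x| = 2 r\<close> this forces that minimum to be either bounded
  away from \<open>0\<close> or at most \<open>O(r\<^sup>2\<^sup>-\<^sup>n)\<close>, and the logarithm excludes the latter for large \<open>r\<close>.
  Once \<open>v \<ge> \<delta>\<close> near infinity, \<open>W'\<close> is bounded away from \<open>0\<close> on \<open>[a + \<delta>, b - e]\<close>, and the same
  paraboloids with \<open>r\<close> large exclude \<open>u(x0) \<le> b - e\<close>.
\<close>

section \<open>Second-order conditions at a local minimum against radial functions\<close>

text \<open>For powers of \<open>q\<close>, the two terms \<open>4 * q * F''\<close> and
  \<open>2 * n * F'\<close> of a radial Laplacian carry the exponents \<open>- 2 - m\<close> and
  \<open>- m - 1\<close>; this brings them to a common power.\<close>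

lemma powr_shift: "t powr (- m - 1) = t * t powr (- 2 - m)" if "t > 0" for t m :: real
proof -
  have "- m - 1 = 1 + (- 2 - m)" by simp
  then show ?thesis using powr_mult_base[of t "- 2 - m"] that by (simp only: less_imp_le)
qed

text \<open>Since \<open>h' 0 = 0\<close>, a negative \<open>D\<close> would make \<open>h'\<close>
  negative just to the right of 0, so that \<open>h\<close> would drop below \<open>h 0\<close>. The
  second derivative has to exist only at 0.\<close>

lemma second_derivative_nonneg_at_local_min:
  fixes h h' :: "real \<Rightarrow> real"
  assumes "e > 0"
    and h: "\<And>t. \<bar>t\<bar> < e \<Longrightarrow> (h has_real_derivative h' t) (at t)"
    and h': "(h' has_real_derivative D) (at 0)"
    and min: "\<And>t. \<bar>t\<bar> < e \<Longrightarrow> h 0 \<le> h t"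
  shows "D \<ge> 0"
proof (rule ccontr)
  assume "\<not> D \<ge> 0"
  then have "D < 0" by simp
  have h'0: "h' 0 = 0"
    using DERIV_local_min[OF h[of 0] \<open>e > 0\<close>] min \<open>e > 0\<close> by simp
  obtain d where "d > 0" and d: "\<And>t. 0 < t \<Longrightarrow> t < d \<Longrightarrow> h' t < 0"
    using DERIV_neg_dec_right[OF h' \<open>D < 0\<close>] h'0 by auto
  define s where "s = min d e / 2"
  have s: "0 < s" "s < d" "s < e"
    using \<open>d > 0\<close> \<open>e > 0\<close> by (auto simp: s_def)
  have "h s < h 0"
  proof (rule DERIV_neg_imp_decreasing_open[OF s(1)])
    fix t assume "0 < t" "t < s"
    then show "\<exists>y. (h has_real_derivative y) (at t) \<and> y < 0"
      using h[of t] d[of t] s by (intro exI[of _ "h' t"]) auto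
  next
    show "continuous_on {0..s} h"
      using s by (intro continuous_at_imp_continuous_on ballI DERIV_isCont[OF h]) auto
  qed
  then show False using min[of s] s by simp
qed

text \<open>At interior points the derivative within \<open>S\<close> is the full derivative, so the
  chain rule along a line applies. It is used for \<open>u\<close> and again for its partial
  derivatives.\<close>

lemma has_derivative_partial_on:
  fixes f :: "'a::euclidean_space \<Rightarrow> real"
  assumes "C1_on S f" "x + t *\<^sub>R v \<in> interior S"
  shows "((\<lambda>t. f (x + t *\<^sub>R v)) has_real_derivative partial_on S v f (x + t *\<^sub>R v)) (at t)"
proof -
  let ?y = "x + t *\<^sub>R v"
  have "f differentiable (at ?y within S)"
    using assms interior_subset unfolding C1_on_def differentiable_on_def by blast
  then have "(f has_derivative frechet_derivative f (at ?y within S)) (at ?y within S)"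
    by (simp add: frechet_derivative_works)
  moreover have "at ?y within S = at ?y"
    by (rule at_within_interior[OF assms(2)])
  ultimately have f: "(f has_derivative frechet_derivative f (at ?y within S)) (at ?y)"
    by metis
  have "((\<lambda>t. x + t *\<^sub>R v) has_derivative (\<lambda>s. s *\<^sub>R v)) (at t)"
    by (auto intro!: derivative_eq_intros)
  from has_derivative_compose[OF this f]
  have "((\<lambda>t. f (x + t *\<^sub>R v)) has_derivative
      (\<lambda>s. frechet_derivative f (at ?y within S) (s *\<^sub>R v))) (at t)" .
  moreover have "(\<lambda>s. frechet_derivative f (at ?y within S) (s *\<^sub>R v))
      = (*) (partial_on S v f ?y)"
    using linear_cmul[OF has_derivative_linear[OF f]] by (auto simp: partial_on_def)
  ultimately show ?thesis
    by (simp add: has_field_derivative_def)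
qed

text \<open>The left side is the Laplacian of \<open>F ((norm (x - c))^2)\<close>. The
  one-dimensional test is applied along every coordinate direction and the results are summed. With
  the squared norm as variable, the restriction to a line is \<open>F\<close> of a quadratic
  polynomial, smooth even at the centre \<open>c\<close>.\<close>

lemma laplacian_ge_radial_at_local_min:
  fixes u :: "'a::euclidean_space \<Rightarrow> real"
  assumes C2: "C2_on S u" and x: "x \<in> interior S" and "e > 0"
    and min: "\<And>y. dist x y < e \<Longrightarrow>
      u x - F ((norm (x - c))\<^sup>2) \<le> u y - F ((norm (y - c))\<^sup>2)"
    and F: "\<And>y. dist x y < e \<Longrightarrow>
      (F has_real_derivative F' ((norm (y - c))\<^sup>2)) (at ((norm (y - c))\<^sup>2))"
    and F': "(F' has_real_derivative F'') (at ((norm (x - c))\<^sup>2))"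
  shows "4 * (norm (x - c))\<^sup>2 * F'' + 2 * real DIM('a) * F' ((norm (x - c))\<^sup>2)
    \<le> laplacian_on S u x"
proof -
  define q where "q = (norm (x - c))\<^sup>2"
  obtain e' where "e' > 0" and e': "ball x e' \<subseteq> S"
    using x mem_interior by blast
  define d where "d = min e e'"
  have "d > 0" using \<open>e > 0\<close> \<open>e' > 0\<close> by (simp add: d_def)
  have ball: "ball x d \<subseteq> interior S"
    by (rule interior_maximal) (use e' d_def in auto)
  have one: "4 * ((x - c) \<bullet> v)\<^sup>2 * F'' + 2 * F' q \<le> partial_on S v (partial_on S v u) x"
    if v: "v \<in> Basis" for v
  proof -
    define Q where "Q = (\<lambda>t. q + 2 * t * ((x - c) \<bullet> v) + t\<^sup>2)"
    have Q: "(norm (x + t *\<^sub>R v - c))\<^sup>2 = Q t" for t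
      using v unfolding Q_def q_def power2_norm_eq_inner
      by (simp add: inner_simps inner_commute power2_eq_square algebra_simps)
    have dist: "dist x (x + t *\<^sub>R v) < d" if "\<bar>t\<bar> < d" for t
      using v that by (simp add: dist_norm)
    have near: "dist x (x + t *\<^sub>R v) < e" if "\<bar>t\<bar> < d" for t
      using dist[OF that] by (simp add: d_def)
    have dQ: "(Q has_real_derivative 2 * ((x - c) \<bullet> v) + 2 * t) (at t)" for t
      unfolding Q_def by (auto intro!: derivative_eq_intros)
    have C1: "C1_on S u" "C1_on S (partial_on S v u)"
      using C2 v by (auto simp: C2_on_def)
    have int: "x + t *\<^sub>R v \<in> interior S" if "\<bar>t\<bar> < d" for t
      using dist[OF that] ball by auto
    have Q0: "Q 0 = q" by (simp add: Q_def)
    \<comment> \<open>The subtracted term is the second derivative of \<open>F (Q t)\<close> at 0,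
      where \<open>Q' 0 = 2 * ((x - c) \<bullet> v)\<close> and \<open>Q'' = 2\<close>.\<close>
    have "0 \<le> partial_on S v (partial_on S v u) x
      - (4 * ((x - c) \<bullet> v)\<^sup>2 * F'' + 2 * F' q)"
    proof (rule second_derivative_nonneg_at_local_min[OF \<open>d > 0\<close>,
          where h = "\<lambda>t. u (x + t *\<^sub>R v) - F (Q t)"
            and h' = "\<lambda>t. partial_on S v u (x + t *\<^sub>R v) - F' (Q t) * (2 * ((x - c) \<bullet> v) + 2 * t)"])
      fix t assume t: "\<bar>t\<bar> < d"
      have "(F has_real_derivative F' (Q t)) (at (Q t))"
        using F[OF near[OF t]] by (simp add: Q)
      from DERIV_chain2[OF this dQ]
      show "((\<lambda>t. u (x + t *\<^sub>R v) - F (Q t)) has_real_derivative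
          partial_on S v u (x + t *\<^sub>R v) - F' (Q t) * (2 * ((x - c) \<bullet> v) + 2 * t)) (at t)"
        by (intro DERIV_diff has_derivative_partial_on[OF C1(1) int[OF t]])
      show "u (x + 0 *\<^sub>R v) - F (Q 0) \<le> u (x + t *\<^sub>R v) - F (Q t)"
        using min[OF near[OF t]] Q0 by (simp add: Q q_def)
    next
      have "(F' has_real_derivative F'') (at (Q 0))"
        using F' by (simp add: Q0 q_def)
      from DERIV_chain2[OF this dQ]
      have "((\<lambda>t. F' (Q t)) has_real_derivative F'' * (2 * ((x - c) \<bullet> v))) (at 0)"
        by simp
      moreover have "((\<lambda>t. 2 * ((x - c) \<bullet> v) + 2 * t) has_real_derivative 2) (at 0)"
        by (auto intro!: derivative_eq_intros)
      ultimately have "((\<lambda>t. F' (Q t) * (2 * ((x - c) \<bullet> v) + 2 * t)) has_real_derivative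
          4 * ((x - c) \<bullet> v)\<^sup>2 * F'' + 2 * F' q) (at 0)"
        by (auto intro!: derivative_eq_intros simp: Q0 power2_eq_square algebra_simps)
      moreover have "((\<lambda>t. partial_on S v u (x + t *\<^sub>R v)) has_real_derivative
          partial_on S v (partial_on S v u) x) (at 0)"
        using has_derivative_partial_on[OF C1(2) int[of 0]] \<open>d > 0\<close> by simp
      ultimately show "((\<lambda>t. partial_on S v u (x + t *\<^sub>R v)
            - F' (Q t) * (2 * ((x - c) \<bullet> v) + 2 * t)) has_real_derivative
          partial_on S v (partial_on S v u) x
            - (4 * ((x - c) \<bullet> v)\<^sup>2 * F'' + 2 * F' q)) (at 0)"
        by (intro DERIV_diff)
    qed
    then show ?thesis by simp
  qed
  have "(\<Sum>v\<in>Basis. 4 * ((x - c) \<bullet> v)\<^sup>2 * F'' + 2 * F' q) \<le> laplacian_on S u x"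
    unfolding laplacian_on_def by (rule sum_mono) (rule one)
  moreover have "(\<Sum>v\<in>Basis. 4 * ((x - c) \<bullet> v)\<^sup>2 * F'' + 2 * F' q)
      = 4 * q * F'' + 2 * real DIM('a) * F' q"
  proof -
    have "q = (\<Sum>v\<in>Basis. ((x - c) \<bullet> v)\<^sup>2)"
      unfolding q_def power2_norm_eq_inner
      by (subst euclidean_inner) (simp add: power2_eq_square)
    then show ?thesis
      by (simp add: sum.distrib sum_distrib_left[symmetric] sum_distrib_right[symmetric])
  qed
  ultimately show ?thesis by (simp add: q_def)
qed

text \<open>Here \<open>g\<close> stands for \<open>W'\<close> and \<open>m\<close> for \<open>(n - 2) / 2\<close>, so that \<open>n / (n - 2) = (m + 1) / m\<close>.\<close>

locale exterior_solution =
  fixes u :: "'a::euclidean_space \<Rightarrow> real" and g :: "real \<Rightarrow> real" and \<rho> a b m :: real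
  assumes dim_eq: "real DIM('a) = 2 * m + 2" and m_ge: "m \<ge> 1 / 2"
    and \<rho>: "\<rho> > 0"
    and C2: "C2_on (- ball 0 \<rho>) u"
    and eqn: "\<And>x. \<rho> \<le> norm x \<Longrightarrow> laplacian_on (- ball 0 \<rho>) u x = g (u x)"
    and range: "\<And>x. \<rho> \<le> norm x \<Longrightarrow> a < u x \<and> u x < b"
    and g_neg: "\<And>s. a < s \<Longrightarrow> s < b \<Longrightarrow> g s < 0"
begin

section \<open>Comparison with radial barriers\<close>

lemma continuous_on_u: "continuous_on {x. \<rho> \<le> norm x} u"
proof -
  have "- ball 0 \<rho> = {x::'a. \<rho> \<le> norm x}" by auto
  then show ?thesis
    using C2 differentiable_imp_continuous_on by (auto simp: C2_on_def C1_on_def)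
qed

lemma interior_domain: "\<rho> < norm x \<Longrightarrow> x \<in> interior (- ball 0 \<rho>)"
  using \<rho> by (simp add: interior_complement)

text \<open>If the barrier exceeded \<open>u\<close> somewhere, \<open>u - F\<close> would have a
  negative minimum over the closed annulus. The boundary conditions make it interior, where the
  Laplacian inequality contradicts \<open>sub\<close>. Since \<open>sub\<close> is required only
  where \<open>u\<close> is below the barrier, its verification may use that upper bound on
  \<open>u\<close>.\<close>

lemma annulus_comparison:
  assumes "\<rho> \<le> R" and R2: "R \<le> R2"
    and F: "\<And>q. q \<ge> R\<^sup>2 \<Longrightarrow> (F has_real_derivative F' q) (at q)"
    and F': "\<And>q. q > R\<^sup>2 \<Longrightarrow> (F' has_real_derivative F'' q) (at q)"
    and inner: "\<And>x. norm x = R \<Longrightarrow> F (R\<^sup>2) \<le> u x"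
    and outer: "\<And>x. norm x = R2 \<Longrightarrow> F (R2\<^sup>2) \<le> u x"
    and sub: "\<And>x. R < norm x \<Longrightarrow> norm x < R2 \<Longrightarrow> u x < F ((norm x)\<^sup>2) \<Longrightarrow>
      g (u x) < 4 * (norm x)\<^sup>2 * F'' ((norm x)\<^sup>2) + 2 * real DIM('a) * F' ((norm x)\<^sup>2)"
    and y: "R \<le> norm y" "norm y \<le> R2"
  shows "F ((norm y)\<^sup>2) \<le> u y"
proof (rule ccontr)
  assume neg: "\<not> F ((norm y)\<^sup>2) \<le> u y"
  have R0: "0 < R" using \<open>\<rho> \<le> R\<close> \<rho> by simp
  define K where "K = cball (0::'a) R2 \<inter> {x. R \<le> norm x}"
  have yK: "y \<in> K" using y by (simp add: K_def)
  have "closed {x::'a. R \<le> norm x}"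
    by (intro closed_Collect_le continuous_intros)
  then have "compact K" unfolding K_def by (intro compact_Int_closed compact_cball)
  have "continuous_on {R\<^sup>2..} F"
    by (intro continuous_at_imp_continuous_on ballI DERIV_isCont[OF F]) auto
  then have "continuous_on K (\<lambda>x. F ((norm x)\<^sup>2))"
    by (rule continuous_on_compose2) (use R0 in \<open>auto intro!: continuous_intros simp: K_def\<close>)
  moreover have "continuous_on K u"
    by (rule continuous_on_subset[OF continuous_on_u]) (use \<open>\<rho> \<le> R\<close> in \<open>auto simp: K_def\<close>)
  ultimately have "continuous_on K (\<lambda>x. u x - F ((norm x)\<^sup>2))"
    by (intro continuous_intros)
  from continuous_attains_inf[OF \<open>compact K\<close> _ this] yK
  obtain x where xK: "x \<in> K"
    and xmin: "\<And>z. z \<in> K \<Longrightarrow> u x - F ((norm x)\<^sup>2) \<le> u z - F ((norm z)\<^sup>2)"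
    by blast
  have neg': "u x < F ((norm x)\<^sup>2)"
    using xmin[OF yK] neg by linarith
  then have x: "R < norm x" "norm x < R2"
    using inner[of x] outer[of x] xK by (auto simp: K_def less_le)
  define e where "e = min (norm x - R) (R2 - norm x)"
  have "e > 0" using x by (simp add: e_def)
  have e: "R < norm z \<and> norm z < R2" if "dist x z < e" for z
  proof -
    have "\<bar>norm z - norm x\<bar> < e"
      using norm_triangle_ineq3[of z x] that by (simp add: dist_norm norm_minus_commute)
    then show ?thesis by (auto simp: e_def)
  qed
  have "4 * (norm (x - 0))\<^sup>2 * F'' ((norm x)\<^sup>2) + 2 * real DIM('a) * F' ((norm (x - 0))\<^sup>2)
      \<le> laplacian_on (- ball 0 \<rho>) u x"
  proof (rule laplacian_ge_radial_at_local_min[OF C2 interior_domain \<open>e > 0\<close>])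
    show "\<rho> < norm x" using x \<open>\<rho> \<le> R\<close> by simp
    show "u x - F ((norm (x - 0))\<^sup>2) \<le> u z - F ((norm (z - 0))\<^sup>2)" if "dist x z < e" for z
      using xmin[of z] e[OF that] by (simp add: K_def)
    show "(F has_real_derivative F' ((norm (z - 0))\<^sup>2)) (at ((norm (z - 0))\<^sup>2))"
      if "dist x z < e" for z
      using F[of "(norm z)\<^sup>2"] e[OF that] R0 by simp
    show "(F' has_real_derivative F'' ((norm x)\<^sup>2)) (at ((norm (x - 0))\<^sup>2))"
      using F'[of "(norm x)\<^sup>2"] x R0 by (simp add: power_strict_mono)
  qed
  then show False
    using sub[OF x neg'] eqn[of x] x \<open>\<rho> \<le> R\<close> by simp
qed

text \<open>The barrier lowered by \<open>e\<close> lies below \<open>a\<close>, hence below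
  \<open>u\<close>, on a sufficiently large sphere because \<open>F\<close> tends to 0. The annulus
  case applies, and \<open>e\<close> is arbitrary.\<close>

lemma exterior_comparison:
  assumes "\<rho> \<le> R"
    and F: "\<And>q. q \<ge> R\<^sup>2 \<Longrightarrow> (F has_real_derivative F' q) (at q)"
    and F': "\<And>q. q > R\<^sup>2 \<Longrightarrow> (F' has_real_derivative F'' q) (at q)"
    and lim: "(F \<longlongrightarrow> 0) at_top"
    and inner: "\<And>x. norm x = R \<Longrightarrow> a + F (R\<^sup>2) \<le> u x"
    and sub: "\<And>x. R < norm x \<Longrightarrow> u x < a + F ((norm x)\<^sup>2) \<Longrightarrow>
      g (u x) < 4 * (norm x)\<^sup>2 * F'' ((norm x)\<^sup>2) + 2 * real DIM('a) * F' ((norm x)\<^sup>2)"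
    and y: "R \<le> norm y"
  shows "a + F ((norm y)\<^sup>2) \<le> u y"
proof (rule field_le_epsilon)
  fix e :: real assume "e > 0"
  have "filterlim (\<lambda>r::real. r\<^sup>2) at_top at_top"
    by (rule filterlim_pow_at_top) (auto intro: filterlim_ident)
  from filterlim_compose[OF lim this]
  have "\<forall>\<^sub>F r in at_top. \<bar>F (r\<^sup>2)\<bar> < e"
    using \<open>e > 0\<close> by (auto dest: tendstoD simp: dist_real_def)
  from eventually_happens[OF eventually_conj[OF this eventually_ge_at_top[of "norm y"]]]
  obtain R2 where R2: "\<bar>F (R2\<^sup>2)\<bar> < e" "norm y \<le> R2" by auto
  have "a + F ((norm y)\<^sup>2) - e \<le> u y"
  proof (rule annulus_comparison[where R = R and ?R2.0 = R2 and F = "\<lambda>q. a + F q - e" and F' = F' and F'' = F''])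
    show "((\<lambda>q. a + F q - e) has_real_derivative F' q) (at q)" if "q \<ge> R\<^sup>2" for q
      using F[OF that] by (auto intro!: derivative_eq_intros)
    show "a + F (R2\<^sup>2) - e \<le> u x" if "norm x = R2" for x
      using range[of x] that R2 y \<open>\<rho> \<le> R\<close> by auto
    show "a + F (R\<^sup>2) - e \<le> u x" if "norm x = R" for x
      using inner[OF that] \<open>e > 0\<close> by simp
    show "g (u x) < 4 * (norm x)\<^sup>2 * F'' ((norm x)\<^sup>2) + 2 * real DIM('a) * F' ((norm x)\<^sup>2)"
      if "R < norm x" "u x < a + F ((norm x)\<^sup>2) - e" for x
      using sub[of x] that \<open>e > 0\<close> by linarith
  qed (use \<open>\<rho> \<le> R\<close> F' y R2 in auto)
  then show "a + F ((norm y)\<^sup>2) \<le> u y + e" by simp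
qed

text \<open>The minimum principle: \<open>u\<close> is strictly superharmonic because
  \<open>g\<close> is negative on its range, so a constant serves as barrier.\<close>

lemma annulus_lower_bound:
  assumes "\<rho> \<le> R" "R \<le> R2"
    and "\<And>x. norm x = R \<Longrightarrow> s \<le> u x" "\<And>x. norm x = R2 \<Longrightarrow> s \<le> u x"
    and "R \<le> norm y" "norm y \<le> R2"
  shows "s \<le> u y"
proof (rule annulus_comparison[where F = "\<lambda>_. s" and F' = "\<lambda>_. 0" and F'' = "\<lambda>_. 0"])
  show "g (u x) < 4 * (norm x)\<^sup>2 * 0 + 2 * real DIM('a) * 0" if "R < norm x" for x
    using range[of x] g_neg that \<open>\<rho> \<le> R\<close> by simp
qed (use assms in auto)

text \<open>In terms of \<open>q = |x|\<^sup>2\<close> the fundamental solution \<open>|x| powr (2 - n)\<close> is \<open>q powr (- m)\<close>.\<close>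

lemma fundamental_lower_bound:
  assumes "\<rho> \<le> R" "M \<ge> 0" and sphere: "\<And>x. norm x = R \<Longrightarrow> a + M \<le> u x"
    and "R \<le> norm y"
  shows "a + M * ((norm y)\<^sup>2 / R\<^sup>2) powr (- m) \<le> u y"
proof (rule exterior_comparison[where R = R
      and F' = "\<lambda>q. M * (- m * (q / R\<^sup>2) powr (- m - 1) / R\<^sup>2)"
      and F'' = "\<lambda>q. M * (m * (m + 1) * (q / R\<^sup>2) powr (- 2 - m) / R\<^sup>2 / R\<^sup>2)"])
  have R: "R > 0" using \<open>\<rho> \<le> R\<close> \<rho> by simp
  then have pos: "q / R\<^sup>2 > 0" if "q \<ge> R\<^sup>2" for q
    using that by (smt (verit) divide_pos_pos zero_less_power)
  show "((\<lambda>q. M * (q / R\<^sup>2) powr (- m)) has_real_derivative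
      M * (- m * (q / R\<^sup>2) powr (- m - 1) / R\<^sup>2)) (at q)" if "q \<ge> R\<^sup>2" for q
    using pos[OF that] R by (auto intro!: derivative_eq_intros simp: divide_simps power2_eq_square)
  show "((\<lambda>q. M * (- m * (q / R\<^sup>2) powr (- m - 1) / R\<^sup>2)) has_real_derivative
      M * (m * (m + 1) * (q / R\<^sup>2) powr (- 2 - m) / R\<^sup>2 / R\<^sup>2)) (at q)" if "q > R\<^sup>2" for q
    using pos[of q] that R
    by (auto intro!: derivative_eq_intros simp: divide_simps power2_eq_square)
      (simp add: algebra_simps)
  show "((\<lambda>q. M * (q / R\<^sup>2) powr (- m)) \<longlongrightarrow> 0) at_top"
  proof -
    have "filterlim (\<lambda>q. q / R\<^sup>2) at_top at_top"
      using R by real_asymp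
    then have "((\<lambda>q. (q / R\<^sup>2) powr (- m)) \<longlongrightarrow> 0) at_top"
      using m_ge by (intro tendsto_neg_powr) auto
    then show ?thesis by (rule tendsto_mult_right_zero)
  qed
  show "a + M * (R\<^sup>2 / R\<^sup>2) powr (- m) \<le> u x" if "norm x = R" for x
    using sphere[OF that] R by simp
  show "g (u x) < 4 * (norm x)\<^sup>2 * (M * (m * (m + 1) * ((norm x)\<^sup>2 / R\<^sup>2) powr (- 2 - m) / R\<^sup>2 / R\<^sup>2))
      + 2 * real DIM('a) * (M * (- m * ((norm x)\<^sup>2 / R\<^sup>2) powr (- m - 1) / R\<^sup>2))"
    if "R < norm x" for x
  proof -
    define s where "s = (norm x)\<^sup>2 / R\<^sup>2"
    have "norm x > 0" using that R by linarith
    then have "s > 0" using R unfolding s_def by (intro divide_pos_pos zero_less_power)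
    \<comment> \<open>The barrier is harmonic: with dimension \<open>2 * m + 2\<close> the
      coefficients \<open>4 * m * (m + 1)\<close> and \<open>- 2 * (2 * m + 2) * m\<close> cancel.
      Strictness then comes from \<open>g (u x) < 0\<close>.\<close>
    from powr_shift[OF this, of m] have "4 * s * R\<^sup>2 * (M * (m * (m + 1) * s powr (- 2 - m) / R\<^sup>2 / R\<^sup>2))
      + 2 * real DIM('a) * (M * (- m * s powr (- m - 1) / R\<^sup>2)) = 0"
      using R unfolding dim_eq by (simp add: field_simps)
    moreover have "s * R\<^sup>2 = (norm x)\<^sup>2" using R by (simp add: s_def)
    moreover have "g (u x) < 0" using range[of x] g_neg that \<open>\<rho> \<le> R\<close> by simp
    ultimately show ?thesis using R by (simp add: s_def mult.assoc)
  qed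
qed (use assms in auto)


text \<open>The power bound \<open>u - a \<ge> c * t powr (- m)\<close> forces
  \<open>g (u x)\<close> below a negative multiple of \<open>t powr (- m - 1)\<close>. The Laplacian
  of the logarithmic barrier is also a negative multiple of this power, so a small
  \<open>\<epsilon>\<close> suffices. On the inner sphere the logarithm vanishes.\<close>

lemma logarithmic_lower_bound:
  assumes "C > 0" "s0 > a"
    and g: "\<And>s. a \<le> s \<Longrightarrow> s \<le> s0 \<Longrightarrow> g s \<le> - C * (s - a) powr ((m + 1) / m)"
    and "c > 0" and sphere: "\<And>x. norm x = \<rho> \<Longrightarrow> a + c \<le> u x"
  obtains \<epsilon> where "\<epsilon> > 0"
    and "\<And>y. \<rho> \<le> norm y \<Longrightarrow>
      a + \<epsilon> * (((norm y)\<^sup>2 / \<rho>\<^sup>2) powr (- m) * ln ((norm y)\<^sup>2 / \<rho>\<^sup>2)) \<le> u y"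
proof -
  define p where "p = (m + 1) / m"
  \<comment> \<open>As \<open>t powr (- m) * ln t \<le> 1 / m\<close> for \<open>t \<ge> 1\<close>,
    the first entry keeps the barrier below \<open>s0\<close>, where \<open>g\<close> has its power
    bound. The second leaves a factor 2 to spare in the comparison of Laplacians.\<close>
  define \<epsilon> where "\<epsilon> = min (m * (s0 - a)) (C * c powr p * \<rho>\<^sup>2 / (8 * m))"
  have m: "m > 0" using m_ge by simp
  have "\<epsilon> > 0" using assms m \<rho> by (simp add: \<epsilon>_def)
  have \<epsilon>1: "\<epsilon> / m \<le> s0 - a"
    using m by (simp add: \<epsilon>_def divide_simps mult.commute)
  have "\<epsilon> * 4 * m / \<rho>\<^sup>2 \<le> (C * c powr p * \<rho>\<^sup>2 / (8 * m)) * 4 * m / \<rho>\<^sup>2"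
    using m by (intro divide_right_mono mult_right_mono) (auto simp: \<epsilon>_def)
  also have "\<dots> = C * c powr p / 2" using m \<rho> by simp
  also have "\<dots> < C * c powr p" using assms by simp
  finally have \<epsilon>2: "\<epsilon> * 4 * m / \<rho>\<^sup>2 < C * c powr p" .
  have "a + \<epsilon> * (((norm y)\<^sup>2 / \<rho>\<^sup>2) powr (- m) * ln ((norm y)\<^sup>2 / \<rho>\<^sup>2)) \<le> u y"
    if "\<rho> \<le> norm y" for y
  proof (rule exterior_comparison[where R = \<rho>
        and F' = "\<lambda>q. \<epsilon> * ((q / \<rho>\<^sup>2) powr (- m - 1) * (1 - m * ln (q / \<rho>\<^sup>2)) / \<rho>\<^sup>2)"
        and F'' = "\<lambda>q. \<epsilon> * ((q / \<rho>\<^sup>2) powr (- 2 - m)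
          * (m * (m + 1) * ln (q / \<rho>\<^sup>2) - 2 * m - 1) / \<rho>\<^sup>2 / \<rho>\<^sup>2)"])
    have pos: "q / \<rho>\<^sup>2 > 0" if "q \<ge> \<rho>\<^sup>2" for q
      using that \<rho> by (smt (verit) divide_pos_pos zero_less_power)
    have dln: "((\<lambda>q. ln (q / \<rho>\<^sup>2)) has_real_derivative 1 / (q / \<rho>\<^sup>2) / \<rho>\<^sup>2) (at q)"
      if "q / \<rho>\<^sup>2 > 0" for q
      using that \<rho> by (auto intro!: derivative_eq_intros)
    have dpowr: "((\<lambda>q. (q / \<rho>\<^sup>2) powr r) has_real_derivative
        r * (q / \<rho>\<^sup>2) powr (r - 1) / \<rho>\<^sup>2) (at q)"
      if "q / \<rho>\<^sup>2 > 0" for q r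
      using that \<rho> by (auto intro!: derivative_eq_intros simp: divide_simps power2_eq_square)
    have step: "t powr (r - 1) = t powr r / t" if "t > 0" for t r :: real
      using that by (simp add: powr_diff)
    show "((\<lambda>q. \<epsilon> * ((q / \<rho>\<^sup>2) powr (- m) * ln (q / \<rho>\<^sup>2))) has_real_derivative
        \<epsilon> * ((q / \<rho>\<^sup>2) powr (- m - 1) * (1 - m * ln (q / \<rho>\<^sup>2)) / \<rho>\<^sup>2)) (at q)"
      if "q \<ge> \<rho>\<^sup>2" for q
    proof -
      define t where "t = q / \<rho>\<^sup>2"
      have t: "t > 0" using pos[OF that] by (simp add: t_def)
      have "\<epsilon> * (t powr (- m - 1) * (1 - m * ln t) / \<rho>\<^sup>2)
        = \<epsilon> * (- m * t powr (- m - 1) / \<rho>\<^sup>2 * ln t + 1 / t / \<rho>\<^sup>2 * t powr (- m))"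
        unfolding step[OF t, of "- m"] using t \<rho> by (simp add: field_simps)
      then show ?thesis
        using DERIV_cmult[OF DERIV_mult[OF dpowr[OF pos[OF that]] dln[OF pos[OF that]]],
            of \<epsilon> "- m"]
        by (simp add: t_def)
    qed
    show "((\<lambda>q. \<epsilon> * ((q / \<rho>\<^sup>2) powr (- m - 1) * (1 - m * ln (q / \<rho>\<^sup>2)) / \<rho>\<^sup>2)) has_real_derivative
        \<epsilon> * ((q / \<rho>\<^sup>2) powr (- 2 - m)
          * (m * (m + 1) * ln (q / \<rho>\<^sup>2) - 2 * m - 1) / \<rho>\<^sup>2 / \<rho>\<^sup>2)) (at q)"
      if "q > \<rho>\<^sup>2" for q
    proof -
      define t where "t = q / \<rho>\<^sup>2"
      have q: "q / \<rho>\<^sup>2 > 0" using pos[of q] that by simp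
      have t: "t > 0" using q by (simp add: t_def)
      have e: "t powr (- 2 - m) = t powr (- m - 1) / t"
        using powr_shift[OF t, of m] t by simp
      have "((\<lambda>q. 1 - m * ln (q / \<rho>\<^sup>2)) has_real_derivative 0 - m * (1 / t / \<rho>\<^sup>2)) (at q)"
        unfolding t_def by (intro DERIV_diff DERIV_const DERIV_cmult dln[OF q])
      from DERIV_cmult[OF DERIV_cdivide[OF DERIV_mult[OF dpowr[OF q, of "- m - 1"] this]],
          of \<epsilon> "\<rho>\<^sup>2"]
      have "((\<lambda>q. \<epsilon> * ((q / \<rho>\<^sup>2) powr (- m - 1) * (1 - m * ln (q / \<rho>\<^sup>2)) / \<rho>\<^sup>2))
          has_real_derivative \<epsilon> * (((- m - 1) * t powr (- m - 1 - 1) / \<rho>\<^sup>2 * (1 - m * ln t)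
            + (0 - m * (1 / t / \<rho>\<^sup>2)) * t powr (- m - 1)) / \<rho>\<^sup>2)) (at q)"
        by (simp add: t_def)
      moreover have "\<epsilon> * (((- m - 1) * t powr (- m - 1 - 1) / \<rho>\<^sup>2 * (1 - m * ln t)
            + (0 - m * (1 / t / \<rho>\<^sup>2)) * t powr (- m - 1)) / \<rho>\<^sup>2)
          = \<epsilon> * (t powr (- 2 - m) * (m * (m + 1) * ln t - 2 * m - 1) / \<rho>\<^sup>2 / \<rho>\<^sup>2)"
        unfolding step[OF t, of "- m - 1"] e using t \<rho> by (simp add: field_simps)
      ultimately show ?thesis by (simp add: t_def)
    qed
    show "((\<lambda>q. \<epsilon> * ((q / \<rho>\<^sup>2) powr (- m) * ln (q / \<rho>\<^sup>2))) \<longlongrightarrow> 0) at_top"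
    proof -
      have "filterlim (\<lambda>q. q / \<rho>\<^sup>2) at_top at_top"
        using \<rho> by real_asymp
      moreover have "((\<lambda>t::real. t powr (- m) * ln t) \<longlongrightarrow> 0) at_top"
        using m by real_asymp
      ultimately have "((\<lambda>q. (q / \<rho>\<^sup>2) powr (- m) * ln (q / \<rho>\<^sup>2)) \<longlongrightarrow> 0) at_top"
        by (rule filterlim_compose[rotated])
      then show ?thesis by (rule tendsto_mult_right_zero)
    qed
    show "a + \<epsilon> * ((\<rho>\<^sup>2 / \<rho>\<^sup>2) powr (- m) * ln (\<rho>\<^sup>2 / \<rho>\<^sup>2)) \<le> u x" if "norm x = \<rho>" for x
      using sphere[OF that] \<rho> \<open>c > 0\<close> by simp
    show "g (u x) < 4 * (norm x)\<^sup>2 * (\<epsilon> * (((norm x)\<^sup>2 / \<rho>\<^sup>2) powr (- 2 - m)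
          * (m * (m + 1) * ln ((norm x)\<^sup>2 / \<rho>\<^sup>2) - 2 * m - 1) / \<rho>\<^sup>2 / \<rho>\<^sup>2))
        + 2 * real DIM('a) * (\<epsilon> * (((norm x)\<^sup>2 / \<rho>\<^sup>2) powr (- m - 1)
          * (1 - m * ln ((norm x)\<^sup>2 / \<rho>\<^sup>2)) / \<rho>\<^sup>2))"
      if x: "\<rho> < norm x"
        and less: "u x < a + \<epsilon> * (((norm x)\<^sup>2 / \<rho>\<^sup>2) powr (- m) * ln ((norm x)\<^sup>2 / \<rho>\<^sup>2))" for x
    proof -
      define t where "t = (norm x)\<^sup>2 / \<rho>\<^sup>2"
      have "\<rho>\<^sup>2 \<le> (norm x)\<^sup>2" using x \<rho> by (intro power_mono) auto
      then have t: "t \<ge> 1" using \<rho> by (simp add: t_def)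
      have "t powr (- m) * ln t \<le> t powr (- m) * (t powr m / m)"
        using ln_powr_bound[OF t m] by (intro mult_left_mono) auto
      also have "\<dots> = 1 / m" using t by (simp add: powr_minus)
      finally have "\<epsilon> * (t powr (- m) * ln t) \<le> \<epsilon> * (1 / m)"
        using \<open>\<epsilon> > 0\<close> by (intro mult_left_mono) auto
      then have "u x \<le> s0" using less \<epsilon>1 by (simp add: t_def)
      have low: "c * t powr (- m) \<le> u x - a"
        using fundamental_lower_bound[of \<rho> c x] sphere x \<open>c > 0\<close> by (simp add: t_def)
      \<comment> \<open>Criticality enters here: \<open>m * p = m + 1\<close>.\<close>
      have "c powr p * t powr (- m - 1) = (c * t powr (- m)) powr p"
      proof -
        have "- m * p = - m - 1" using m by (simp add: p_def)
        then show ?thesis using t \<open>c > 0\<close> by (simp add: powr_mult powr_powr)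
      qed
      also have "\<dots> \<le> (u x - a) powr p"
        using low m \<open>c > 0\<close> by (intro powr_mono2) (auto simp: p_def)
      finally have "C * (c powr p * t powr (- m - 1)) \<le> C * (u x - a) powr p"
        using \<open>C > 0\<close> by (intro mult_left_mono) auto
      then have "g (u x) \<le> - (C * c powr p) * t powr (- m - 1)"
        using g[of "u x"] range[of x] x \<open>u x \<le> s0\<close> by (simp add: p_def)
      also have "\<dots> < - (\<epsilon> * 4 * m / \<rho>\<^sup>2) * t powr (- m - 1)"
        using \<epsilon>2 t by (intro mult_strict_right_mono) auto
      \<comment> \<open>The logarithms cancel because \<open>t powr (- m)\<close> is harmonic; what
        remains is \<open>- 4 * (2 * m + 1) + 2 * (2 * m + 2) = - 4 * m\<close>.\<close>
      also have "\<dots> = 4 * (t * \<rho>\<^sup>2) * (\<epsilon> * (t powr (- 2 - m)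
          * (m * (m + 1) * ln t - 2 * m - 1) / \<rho>\<^sup>2 / \<rho>\<^sup>2))
        + 2 * real DIM('a) * (\<epsilon> * (t powr (- m - 1) * (1 - m * ln t) / \<rho>\<^sup>2))"
      proof -
        have "t > 0" using t by simp
        then show ?thesis
          unfolding dim_eq powr_shift[OF \<open>t > 0\<close>] using \<rho> by (simp add: field_simps)
      qed
      finally show ?thesis using \<rho> by (simp add: t_def)
    qed
  qed (use that in auto)
  then show ?thesis using that \<open>\<epsilon> > 0\<close> by blast
qed

section \<open>Touching paraboloids and a uniform gap above \<open>a\<close>\<close>

text \<open>The opening \<open>k\<close> makes the added quadratic equal to \<open>u x0 - a\<close>
  on the sphere of radius \<open>r\<close>. As \<open>u > a\<close>, the sum \<open>h\<close> there
  exceeds \<open>u x0 = h x0\<close>, so its minimum is interior and the Laplacian of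
  \<open>u\<close> is at least \<open>- 2 * n * k\<close> at that point.\<close>

lemma touching_paraboloid:
  assumes "r > 0" and dom: "\<And>y. dist x0 y \<le> r \<Longrightarrow> \<rho> \<le> norm y"
  obtains x where "dist x0 x < r" "u x \<le> u x0"
    and "- g (u x) \<le> 2 * real DIM('a) * (u x0 - a) / r\<^sup>2"
proof -
  define k where "k = (u x0 - a) / r\<^sup>2"
  define h where "h = (\<lambda>y. u y + k * (norm (y - x0))\<^sup>2)"
  have "continuous_on (cball x0 r) u"
    by (rule continuous_on_subset[OF continuous_on_u]) (use dom in auto)
  then have "continuous_on (cball x0 r) h"
    unfolding h_def by (intro continuous_intros)
  from continuous_attains_inf[OF compact_cball _ this] \<open>r > 0\<close>
  obtain x where x: "dist x0 x \<le> r" and min: "\<And>z. dist x0 z \<le> r \<Longrightarrow> h x \<le> h z"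
    by (auto simp: Ball_def)
  have hx: "h x \<le> u x0" using min[of x0] \<open>r > 0\<close> by (simp add: h_def)
  have "u x0 > a" using range[of x0] dom[of x0] \<open>r > 0\<close> by simp
  then have k: "k \<ge> 0" by (simp add: k_def)
  have ux: "u x \<le> u x0" using hx k unfolding h_def by (smt (verit) mult_nonneg_nonneg zero_le_power2)
  have lt: "dist x0 x < r"
  proof (rule ccontr)
    assume "\<not> dist x0 x < r"
    then have "norm (x - x0) = r" using x by (simp add: dist_norm norm_minus_commute)
    then have "h x = u x + (u x0 - a)" using \<open>r > 0\<close> by (simp add: h_def k_def)
    then show False using hx range[of x] dom[OF x] by simp
  qed
  have int: "x \<in> interior (- ball 0 \<rho>)"
  proof (rule interiorI[of "ball x0 r"])
    show "ball x0 r \<subseteq> - ball 0 \<rho>"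
    proof
      fix y assume "y \<in> ball x0 r"
      then show "y \<in> - ball 0 \<rho>" using dom[of y] by simp
    qed
  qed (use lt in auto)
  have "4 * (norm (x - x0))\<^sup>2 * 0 + 2 * real DIM('a) * - k \<le> laplacian_on (- ball 0 \<rho>) u x"
  proof (rule laplacian_ge_radial_at_local_min[OF C2 int,
        where F = "\<lambda>q. - k * q" and F' = "\<lambda>_. - k" and c = x0 and e = "r - dist x0 x"])
    show "u x - - k * (norm (x - x0))\<^sup>2 \<le> u y - - k * (norm (y - x0))\<^sup>2"
      if "dist x y < r - dist x0 x" for y
      using min[of y] that dist_triangle[of x0 y x] by (simp add: h_def)
  qed (use lt in \<open>auto intro!: derivative_eq_intros\<close>)
  then have "- g (u x) \<le> 2 * real DIM('a) * (u x0 - a) / r\<^sup>2"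
    using eqn[of x] dom[OF x] by (simp add: k_def)
  then show ?thesis using that lt ux by blast
qed

lemma sphere_minimum:
  assumes "\<rho> \<le> R"
  obtains x0 where "norm x0 = R" "\<And>x. norm x = R \<Longrightarrow> u x0 \<le> u x"
proof -
  have "continuous_on (sphere 0 R) u"
    by (rule continuous_on_subset[OF continuous_on_u]) (use assms in auto)
  moreover have "sphere (0::'a) R \<noteq> {}" using assms \<rho> by (simp add: sphere_eq_empty)
  ultimately obtain x0 where "x0 \<in> sphere 0 R" "\<forall>x\<in>sphere 0 R. u x0 \<le> u x"
    using continuous_attains_inf[OF compact_sphere] by blast
  then show ?thesis using that[of x0] by auto
qed

text \<open>Let \<open>M\<close> be the minimum of \<open>u - a\<close> on the sphere of radius
  \<open>2 * r\<close>. If \<open>M < \<delta>\<close>, a paraboloid touching near a minimum point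
  gives \<open>M \<le> (K / r^2) powr m\<close>, which the logarithmic bound excludes for large
  \<open>r\<close>.\<close>

lemma eventually_bounded_below:
  assumes "C > 0" "s0 > a"
    and g: "\<And>s. a \<le> s \<Longrightarrow> s \<le> s0 \<Longrightarrow> g s \<le> - C * (s - a) powr ((m + 1) / m)"
  obtains \<delta> R where "\<delta> > 0" "R \<ge> \<rho>" "\<And>x. R \<le> norm x \<Longrightarrow> a + \<delta> \<le> u x"
proof -
  have m: "m > 0" using m_ge by simp
  obtain z where z: "norm z = \<rho>" "\<And>x. norm x = \<rho> \<Longrightarrow> u z \<le> u x"
    using sphere_minimum[of \<rho>] by auto
  define c where "c = u z - a"
  have "c > 0" using range[of z] z by (simp add: c_def)
  have inner: "a + c \<le> u x" if "norm x = \<rho>" for x using z(2)[OF that] by (simp add: c_def)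
  obtain \<epsilon> where "\<epsilon> > 0" and log: "\<And>y. \<rho> \<le> norm y \<Longrightarrow>
      a + \<epsilon> * (((norm y)\<^sup>2 / \<rho>\<^sup>2) powr (- m) * ln ((norm y)\<^sup>2 / \<rho>\<^sup>2)) \<le> u y"
    using logarithmic_lower_bound[OF assms \<open>c > 0\<close> inner] by metis
  \<comment> \<open>\<open>M < c\<close> lets the minimum principle run between the spheres of
    radius \<open>\<rho>\<close> and \<open>2 * r\<close>; \<open>M < s0 - a\<close> puts the
    touching value where the power bound on \<open>g\<close> holds.\<close>
  define \<delta> where "\<delta> = min c (s0 - a)"
  \<comment> \<open>The ratio 9/4 is \<open>(3 * r)^2 / (2 * r)^2\<close>: the touching ball reaches
    out to radius \<open>3 * r\<close>.\<close>
  define K where "K = 2 * real DIM('a) * (9 / 4) powr (m + 1) / C"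
  \<comment> \<open>The contradiction will be \<open>t \<le> E\<close> against
    \<open>t \<ge> 4 * E * E\<close> for \<open>t = (2 * r)^2 / \<rho>^2\<close>; the maximum with 1
    ensures \<open>E \<le> E * E\<close> and \<open>\<rho> \<le> r\<close>.\<close>
  define E where "E = max 1 (exp ((4 * K / \<rho>\<^sup>2) powr m / \<epsilon>))"
  have "\<delta> > 0" using \<open>c > 0\<close> assms by (simp add: \<delta>_def)
  have "K > 0" using \<open>C > 0\<close> by (simp add: K_def)
  have "a + \<delta> \<le> u x" if x: "2 * (\<rho> * E) \<le> norm x" for x
  proof -
    define r where "r = norm x / 2"
    have r: "\<rho> * E \<le> r" using x by (simp add: r_def)
    have "E \<ge> 1" by (simp add: E_def)
    then have "\<rho> \<le> \<rho> * E" using \<rho> by simp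
    then have "\<rho> \<le> r" using r by simp
    then have "r > 0" using \<rho> by simp
    obtain x0 where x0: "norm x0 = 2 * r" "\<And>x. norm x = 2 * r \<Longrightarrow> u x0 \<le> u x"
      using sphere_minimum[of "2 * r"] \<open>\<rho> \<le> r\<close> \<open>r > 0\<close> by auto
    define M where "M = u x0 - a"
    have "M > 0" using range[of x0] x0(1) \<open>\<rho> \<le> r\<close> \<open>r > 0\<close> by (simp add: M_def)
    have "\<delta> \<le> M"
    proof (rule ccontr)
      assume "\<not> \<delta> \<le> M"
      then have M: "M < c" "M < s0 - a" by (auto simp: \<delta>_def)
      have dom: "r \<le> norm y \<and> norm y \<le> 3 * r" if "dist x0 y \<le> r" for y
        using that x0(1) norm_triangle_ineq2[of x0 y] norm_triangle_ineq2[of y x0]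
        by (simp add: dist_norm norm_minus_commute)
      obtain y where y: "dist x0 y < r" "u y \<le> u x0"
        and gy: "- g (u y) \<le> 2 * real DIM('a) * (u x0 - a) / r\<^sup>2"
        using touching_paraboloid[OF \<open>r > 0\<close>, of x0] dom \<open>\<rho> \<le> r\<close> by (metis order.trans)
      have y': "r \<le> norm y" "norm y \<le> 3 * r" using dom[of y] y by auto
      \<comment> \<open>Inside the sphere of radius \<open>2 * r\<close> the minimum principle gives
        the full \<open>M\<close>; outside, \<open>u - a\<close> decays at worst like the
        fundamental solution.\<close>
      have low: "M * (9 / 4) powr (- m) \<le> u y - a"
      proof (cases "norm y \<le> 2 * r")
        case True
        have "a + M \<le> u y"
          by (rule annulus_lower_bound[where R = \<rho> and ?R2.0 = "2 * r"])
            (use True y' \<open>\<rho> \<le> r\<close> \<open>r > 0\<close> x0(2) inner M in \<open>force simp: M_def\<close>)+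
        moreover have "(9 / 4 :: real) powr (- m) \<le> 1"
          using powr_mono[of "- m" 0 "9 / 4 :: real"] m by simp
        then have "M * (9 / 4) powr (- m) \<le> M * 1"
          using \<open>M > 0\<close> by (intro mult_left_mono) auto
        ultimately show ?thesis by simp
      next
        case False
        have "a + M * ((norm y)\<^sup>2 / (2 * r)\<^sup>2) powr (- m) \<le> u y"
          by (rule fundamental_lower_bound)
            (use False \<open>\<rho> \<le> r\<close> \<open>r > 0\<close> x0(2) \<open>M > 0\<close> in \<open>auto simp: M_def\<close>)
        moreover have "(9 / 4) powr (- m) \<le> ((norm y)\<^sup>2 / (2 * r)\<^sup>2) powr (- m)"
        proof (rule powr_mono2')
          have "(norm y)\<^sup>2 \<le> (3 * r)\<^sup>2" using y' by (intro power_mono) auto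
          then show "(norm y)\<^sup>2 / (2 * r)\<^sup>2 \<le> 9 / 4"
            using \<open>r > 0\<close> by (simp add: divide_simps power_mult_distrib)
          show "0 < (norm y)\<^sup>2 / (2 * r)\<^sup>2"
            using y' \<open>r > 0\<close> by (intro divide_pos_pos zero_less_power) auto
        qed (use m in auto)
        then have "M * (9 / 4) powr (- m) \<le> M * ((norm y)\<^sup>2 / (2 * r)\<^sup>2) powr (- m)"
          using \<open>M > 0\<close> by (intro mult_left_mono) auto
        ultimately show ?thesis by simp
      qed
      \<comment> \<open>Since \<open>M powr ((m + 1) / m) = M * B\<close>, one factor
        \<open>M\<close> cancels against the paraboloid bound, leaving \<open>B\<close> of order
        \<open>1 / r^2\<close>.\<close>
      define B where "B = M powr (1 / m)"
      have "M * B * (9 / 4) powr (- (m + 1)) = (M * (9 / 4) powr (- m)) powr ((m + 1) / m)"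
      proof -
        have "(m + 1) / m = 1 + 1 / m" using m by (simp add: field_simps)
        then have "M powr ((m + 1) / m) = M * B"
          using \<open>M > 0\<close> by (simp add: powr_add B_def)
        moreover have "((9 / 4 :: real) powr (- m)) powr ((m + 1) / m) = (9 / 4) powr (- (m + 1))"
          unfolding powr_powr using m by simp
        ultimately show ?thesis using \<open>M > 0\<close> by (simp add: powr_mult)
      qed
      also have "\<dots> \<le> (u y - a) powr ((m + 1) / m)"
        using low m \<open>M > 0\<close> by (intro powr_mono2) auto
      finally have "C * (M * B * (9 / 4) powr (- (m + 1))) \<le> C * (u y - a) powr ((m + 1) / m)"
        using \<open>C > 0\<close> by (intro mult_left_mono) auto
      also have "\<dots> \<le> - g (u y)"
        using g[of "u y"] range[of y] y y' M \<open>\<rho> \<le> r\<close> by (simp add: M_def)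
      also have "\<dots> \<le> 2 * real DIM('a) * M / r\<^sup>2" using gy by (simp add: M_def)
      finally have "M * (C * (9 / 4) powr (- (m + 1)) * B) \<le> M * (2 * real DIM('a) / r\<^sup>2)"
        by (simp add: mult_ac)
      then have "C * (9 / 4) powr (- (m + 1)) * B \<le> 2 * real DIM('a) / r\<^sup>2"
        using \<open>M > 0\<close> mult_le_cancel_left_pos by blast
      then have "B \<le> K / r\<^sup>2"
        using \<open>C > 0\<close> \<open>r > 0\<close> unfolding K_def powr_minus by (simp add: field_simps)
      then have "B powr m \<le> (K / r\<^sup>2) powr m"
        using m by (intro powr_mono2) (auto simp: B_def)
      moreover have "B powr m = M" using m \<open>M > 0\<close> by (simp add: B_def powr_powr)
      ultimately have up: "M \<le> (K / r\<^sup>2) powr m" by simp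
      define t where "t = (2 * r)\<^sup>2 / \<rho>\<^sup>2"
      have "t > 0" using \<open>r > 0\<close> \<rho> by (simp add: t_def)
      have "\<epsilon> * (t powr (- m) * ln t) \<le> M"
        using log[of x0] x0(1) \<open>\<rho> \<le> r\<close> \<open>r > 0\<close> by (simp add: t_def M_def)
      also note up
      \<comment> \<open>Multiplying by \<open>t powr m\<close> removes every power of
        \<open>r\<close> and leaves a bound on \<open>ln t\<close> independent of
        \<open>r\<close>.\<close>
      finally have "\<epsilon> * (t powr (- m) * ln t) * t powr m \<le> (K / r\<^sup>2) powr m * t powr m"
        by (intro mult_right_mono) auto
      also have "\<dots> = (4 * K / \<rho>\<^sup>2) powr m"
      proof -
        have "K / r\<^sup>2 * t = 4 * K / \<rho>\<^sup>2" using \<open>r > 0\<close> by (simp add: t_def power_mult_distrib)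
        then show ?thesis using \<open>K > 0\<close> \<open>t > 0\<close> by (simp flip: powr_mult)
      qed
      also have "\<epsilon> * (t powr (- m) * ln t) * t powr m = \<epsilon> * ln t"
        using \<open>t > 0\<close> by (simp add: powr_minus)
      finally have "ln t \<le> (4 * K / \<rho>\<^sup>2) powr m / \<epsilon>"
        using \<open>\<epsilon> > 0\<close> by (simp add: field_simps)
      then have "t \<le> exp ((4 * K / \<rho>\<^sup>2) powr m / \<epsilon>)"
        using \<open>t > 0\<close> by (metis exp_le_cancel_iff exp_ln)
      then have "t \<le> E" by (simp add: E_def)
      moreover have "E \<le> r / \<rho>" using r \<rho> by (simp add: field_simps)
      then have "E * E \<le> (r / \<rho>)\<^sup>2"
        unfolding power2_eq_square using \<open>E \<ge> 1\<close> by (intro mult_mono) auto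
      then have "4 * (E * E) \<le> t" by (simp add: t_def power_divide power_mult_distrib)
      moreover have "E \<le> E * E" using \<open>E \<ge> 1\<close> by simp
      ultimately show False using \<open>E \<ge> 1\<close> by linarith
    qed
    then show ?thesis using x0(2)[of x] by (simp add: M_def r_def)
  qed
  moreover have "2 * (\<rho> * E) \<ge> \<rho>"
  proof -
    have "\<rho> * 1 \<le> \<rho> * E" using \<rho> by (intro mult_left_mono) (auto simp: E_def)
    then show ?thesis using \<rho> by simp
  qed
  ultimately show ?thesis using that \<open>\<delta> > 0\<close> by blast
qed

section \<open>Convergence to \<open>b\<close>\<close>

text \<open>Once \<open>u \<ge> a + \<delta>\<close>, compactness bounds \<open>- g\<close> below by
  some \<open>\<mu> > 0\<close> at values up to \<open>b - e\<close>, while touching paraboloids of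
  large radius make \<open>- g\<close> smaller than \<open>\<mu>\<close>.\<close>

lemma tendsto_upper_zero:
  assumes "C > 0" "s0 > a"
    and g: "\<And>s. a \<le> s \<Longrightarrow> s \<le> s0 \<Longrightarrow> g s \<le> - C * (s - a) powr ((m + 1) / m)"
    and cont: "continuous_on {a<..<b} g"
  shows "(u \<longlongrightarrow> b) at_infinity"
proof (rule tendstoI)
  fix e :: real assume "e > 0"
  obtain \<delta> R where "\<delta> > 0" "R \<ge> \<rho>" and low: "\<And>x. R \<le> norm x \<Longrightarrow> a + \<delta> \<le> u x"
    using eventually_bounded_below[OF assms(1-3)] by metis
  define I where "I = {a + \<delta>..b - e}"
  obtain \<mu> where "\<mu> > 0" and \<mu>: "\<And>s. s \<in> I \<Longrightarrow> \<mu> \<le> - g s"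
  proof (cases "I = {}")
    \<comment> \<open>For large \<open>e\<close> the interval is empty and any positive
      \<open>\<mu>\<close> will do.\<close>
    case True
    then show ?thesis using that[of 1] by simp
  next
    case False
    have sub: "I \<subseteq> {a<..<b}" using \<open>\<delta> > 0\<close> \<open>e > 0\<close> by (auto simp: I_def)
    have "continuous_on I (\<lambda>s. - g s)"
      by (intro continuous_intros continuous_on_subset[OF cont sub])
    then obtain s where "s \<in> I" "\<And>t. t \<in> I \<Longrightarrow> - g s \<le> - g t"
      using continuous_attains_inf[of I "\<lambda>s. - g s"] False by (auto simp: I_def)
    then show ?thesis using that[of "- g s"] g_neg[of s] sub by auto
  qed
  \<comment> \<open>The square root balances \<open>2 * n * (b - a) / r^2\<close> with
    \<open>\<mu>\<close>; adding 1 makes the inequality strict.\<close>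
  define r where "r = sqrt (2 * real DIM('a) * (b - a) / \<mu>) + 1"
  \<comment> \<open>Any value of \<open>u\<close> separates \<open>a\<close> from \<open>b\<close>;
    a point of norm \<open>R\<close> supplies one.\<close>
  have "b > a" using range[of "R *\<^sub>R (SOME i. i \<in> Basis)"] \<open>R \<ge> \<rho>\<close> \<rho>
    by (simp add: some_in_eq)
  then have rr: "2 * real DIM('a) * (b - a) / \<mu> < r\<^sup>2" and "r > 0"
    using \<open>\<mu> > 0\<close> by (simp_all add: r_def power2_sum add_nonneg_pos)
  have "dist (u x) b < e" if x: "R + r \<le> norm x" for x
  proof (rule ccontr)
    assume "\<not> dist (u x) b < e"
    moreover have bd: "a < u x" "u x < b" using range[of x] x \<open>R \<ge> \<rho>\<close> \<open>r > 0\<close> by auto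
    ultimately have ux: "u x \<le> b - e" by (auto simp: dist_real_def)
    have dom: "R \<le> norm y" if "dist x y \<le> r" for y
      using that x norm_triangle_ineq2[of x y] by (simp add: dist_norm)
    obtain y where y: "dist x y < r" "u y \<le> u x"
      and gy: "- g (u y) \<le> 2 * real DIM('a) * (u x - a) / r\<^sup>2"
      using touching_paraboloid[OF \<open>r > 0\<close>, of x] dom \<open>R \<ge> \<rho>\<close> by (metis order.trans)
    have "u y \<in> I" using low[of y] dom[of y] y ux by (auto simp: I_def)
    then have "\<mu> \<le> 2 * real DIM('a) * (u x - a) / r\<^sup>2" using \<mu> gy by force
    also have "\<dots> \<le> 2 * real DIM('a) * (b - a) / r\<^sup>2"
      using bd by (intro divide_right_mono mult_left_mono) auto
    also have "\<dots> < \<mu>"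
      using rr \<open>\<mu> > 0\<close> \<open>r > 0\<close> by (simp add: field_simps)
    finally show False by simp
  qed
  then show "\<forall>\<^sub>F x in at_infinity. dist (u x) b < e"
    unfolding eventually_at_infinity by blast
qed

end

theorem proposition2p2:
  fixes u :: "real ^ 'n \<Rightarrow> real" and W :: "real \<Rightarrow> real" and \<rho> a b C\<^sub>0 s\<^sub>0 :: real
  assumes "CARD('n) \<ge> 3"
    and "\<rho> > 0"
    and "a < b"
    and "C11_loc W"
    and "deriv W a = 0" and "deriv W b = 0"
    and "\<forall>s\<in>{a<..<b}. deriv W s < 0"
    and "C\<^sub>0 > 0" and "s\<^sub>0 \<in> {a<..<b}"
    and "\<forall>s\<in>{a..s\<^sub>0}. deriv W s \<le> - C\<^sub>0 * (s - a) powr (real CARD('n) / (real CARD('n) - 2))"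
    and "C2_on (- ball 0 \<rho>) u"
    and "\<forall>x\<in>- ball 0 \<rho>. laplacian_on (- ball 0 \<rho>) u x = deriv W (u x)"
    and "u ` (- ball 0 \<rho>) \<subseteq> {a<..<b}"
  shows "(u \<longlongrightarrow> b) at_infinity"
proof -
  define m where "m = (real CARD('n) - 2) / 2"
  have dom: "x \<in> - ball 0 \<rho> \<longleftrightarrow> \<rho> \<le> norm x" for x :: "real ^ 'n"
    by auto
  interpret exterior_solution u "deriv W" \<rho> a b m
  proof
    show "real DIM(real ^ 'n) = 2 * m + 2" by (simp add: m_def field_simps)
    show "1 / 2 \<le> m" using assms(1) by (simp add: m_def)
    show "a < u x \<and> u x < b" if "\<rho> \<le> norm x" for x
      using assms(13) that dom[of x] by (auto simp: image_subset_iff)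
    show "laplacian_on (- ball 0 \<rho>) u x = deriv W (u x)" if "\<rho> \<le> norm x" for x
      using assms(12) that dom[of x] by blast
  qed (use assms in auto)
  have exponent: "(m + 1) / m = real CARD('n) / (real CARD('n) - 2)"
    using assms(1) by (simp add: m_def field_simps)
  \<comment> \<open>The local Lipschitz bound supplies the continuity of \<open>deriv W\<close>
    behind the compactness argument.\<close>
  obtain L where "L-lipschitz_on {a..b} (deriv W)"
    using assms(4) compact_Icc unfolding C11_loc_def by blast
  then have "continuous_on {a<..<b} (deriv W)"
    by (rule continuous_on_subset[OF lipschitz_on_continuous_on]) auto
  then show ?thesis
    by (rule tendsto_upper_zero[OF \<open>C\<^sub>0 > 0\<close>, of s\<^sub>0, rotated -1])
      (use assms in \<open>auto simp: exponent\<close>)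
qed

end
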